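(* Let $A_1,\ldots,A_r\in\mathbb{R}_+^{n\times n}$ commute in pairs in max algebra and let $p(x_1,\ldots,x_r)$ be a max polynomial. Then: (i) For each $i\in\{1,\ldots,r\}$ and each $\alpha_i\in\Lambda(A_i)$ there exist $\alpha_j\in\Lambda(A_j)$ for all $j\neq i$ such that $p(\alpha_1,\ldots,\alpha_r)\in\Lambda(p(A_1,\ldots,A_r))$. (ii) For each $\lambda\in\Lambda(p(A_1,\ldots,A_r))$ there exist $\alpha_i\in\Lambda(A_i)$ for all $i=1,\ldots,r$ such that $\lambda=p(\alpha_1,\ldots,\alpha_r)$.
   Context: Max algebra is the semiring $(\mathbb{R}_+,\oplus,\times)$, where $\mathbb{R}_+=[0,\infty)$, $a\oplus b=\max(a,b)$ and $\times$ is ordinary multiplication. All matrix and matrix-vector operations are over this semiring: $(A\oplus B)_{ij}=\max(a_{ij},b_{ij})$, $(AB)_{ij}=\max_k a_{ik}b_{kj}$, $(Av)_i=\max_k a_{ik}v_k$, and powers are iterated max-algebraic products. An eigenvalue of $A\in\mathbb{R}_+^{n\times n}$ is an $\alpha\in\mathbb{R}_+$ for which there is a nonzero $v\in\mathbb{R}_+^n$ with $Av=\alpha v$; $\Lambda(A)$ denotes the set of eigenvalues of $A$. A max polynomial is obtained from a real polynomial with nonnegative coefficients by replacing the usual sum by the maximum. For pairwise commuting matrices, $p(A_1,\ldots,A_r)$ is obtained by substituting $A_i$ for $x_i$, with max-algebraic matrix operations and a constant term $c$ read as $cI$, where $I$ is the unit matrix. *)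

theory Defs
  imports "HOL-Analysis.Analysis" "HOL-Library.Poly_Mapping"
begin

text \<open>
  Max algebra is the semiring of nonnegative reals with maximum as addition and the usual
  multiplication. Its elements are represented as plain reals, so nonnegativity appears as an
  explicit side condition. The ordinary zero and one are also the neutral elements of max algebra;
  hence the unit matrix is \<^term>\<open>mat 1 :: real^'n^'n\<close> and empty max-algebraic sums are 0.
\<close>

definition nonneg_matrix :: "real^'n^'m \<Rightarrow> bool" where
  "nonneg_matrix A \<longleftrightarrow> (\<forall>i j. 0 \<le> A $ i $ j)"

definition nonneg_vector :: "real^'n \<Rightarrow> bool" where
  "nonneg_vector v \<longleftrightarrow> (\<forall>i. 0 \<le> v $ i)"

definition max_matrix_mult :: "real^'k^'m \<Rightarrow> real^'n^'k \<Rightarrow> real^'n^'m"  (infixl \<open>\<otimes>\<^sub>m\<close> 70)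
  where "A \<otimes>\<^sub>m B = (\<chi> i j. MAX k. A $ i $ k * B $ k $ j)"

definition max_matrix_vector_mult :: "real^'n^'m \<Rightarrow> real^'n \<Rightarrow> real^'m"  (infixl \<open>\<otimes>\<^sub>v\<close> 70)
  where "A \<otimes>\<^sub>v v = (\<chi> i. MAX k. A $ i $ k * v $ k)"

primrec max_matrix_power :: "real^'n^'n \<Rightarrow> nat \<Rightarrow> real^'n^'n" where
  "max_matrix_power A 0 = mat 1"
| "max_matrix_power A (Suc k) = A \<otimes>\<^sub>m max_matrix_power A k"

definition max_eigenvalues :: "real^'n^'n \<Rightarrow> real set"  (\<open>\<Lambda>\<close>) where
  "\<Lambda> A = {\<alpha>. 0 \<le> \<alpha> \<and> (\<exists>v. nonneg_vector v \<and> v \<noteq> 0 \<and> A \<otimes>\<^sub>v v = \<alpha> *\<^sub>R v)}"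

text \<open>
  For nonnegative summands the inserted 0 only matters when \<^term>\<open>S\<close> is empty.
\<close>

definition max_sum :: "('a \<Rightarrow> real) \<Rightarrow> 'a set \<Rightarrow> real" where
  "max_sum f S = Max (insert 0 (f ` S))"

text \<open>
  A multivariate polynomial with real coefficients is a finitely supported map from exponent
  vectors to coefficients, where an exponent vector is a finitely supported map from variable
  indices to exponents. The coefficient of the monomial \<^term>\<open>m\<close> in \<^term>\<open>p\<close> is
  \<^term>\<open>Poly_Mapping.lookup p m\<close>, the exponent of variable number \<^term>\<open>i\<close> in
  \<^term>\<open>m\<close> is \<^term>\<open>Poly_Mapping.lookup m i\<close>.
  The predicate below says that \<^term>\<open>p\<close> is a polynomial in the variables with indices 1 to
  \<^term>\<open>r\<close> and has nonnegative coefficients, so that it determines a max polynomial.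
\<close>

type_synonym real_mpoly = "(nat \<Rightarrow>\<^sub>0 nat) \<Rightarrow>\<^sub>0 real"

definition max_polynomial :: "nat \<Rightarrow> real_mpoly \<Rightarrow> bool" where
  "max_polynomial r p \<longleftrightarrow>
     (\<forall>m. 0 \<le> Poly_Mapping.lookup p m) \<and>
     (\<forall>m \<in> Poly_Mapping.keys p. Poly_Mapping.keys m \<subseteq> {1..r})"

definition max_poly_eval :: "nat \<Rightarrow> real_mpoly \<Rightarrow> (nat \<Rightarrow> real) \<Rightarrow> real" where
  "max_poly_eval r p x =
     max_sum (\<lambda>m. Poly_Mapping.lookup p m * (\<Prod>i = 1..r. x i ^ Poly_Mapping.lookup m i))
       (Poly_Mapping.keys p)"

text \<open>
  The factors are multiplied in the order of increasing index; for pairwise commuting matrices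
  the order is irrelevant. The monomial with all exponents zero yields the unit matrix, so a
  constant term c contributes c times the unit matrix.
\<close>

definition max_matrix_monomial :: "nat \<Rightarrow> (nat \<Rightarrow>\<^sub>0 nat) \<Rightarrow> (nat \<Rightarrow> real^'n^'n) \<Rightarrow> real^'n^'n" where
  "max_matrix_monomial r m A =
     foldr (\<lambda>i M. max_matrix_power (A i) (Poly_Mapping.lookup m i) \<otimes>\<^sub>m M) [1..<Suc r] (mat 1)"

definition max_poly_matrix_eval :: "nat \<Rightarrow> real_mpoly \<Rightarrow> (nat \<Rightarrow> real^'n^'n) \<Rightarrow> real^'n^'n" where
  "max_poly_matrix_eval r p A =
     (\<chi> i j. max_sum (\<lambda>m. Poly_Mapping.lookup p m * max_matrix_monomial r m A $ i $ j)
       (Poly_Mapping.keys p))"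

end

theory Submission imports Defs begin

text \<open>
  The theorem reduces to finding one vector that is an eigenvector of all \<open>A\<^sub>j\<close> at once. If
  \<open>v\<close> is nonzero and \<open>A\<^sub>j v = \<alpha>\<^sub>j v\<close> for all \<open>j\<close>, then every monomial of \<open>p\<close> acts on \<open>v\<close> as
  multiplication by its value at \<open>\<alpha>\<close>, hence \<open>p(A) v = p(\<alpha>) v\<close>. For part (i) such a \<open>v\<close> is looked
  for among the eigenvectors of \<open>A\<^sub>i\<close> for the given eigenvalue, for part (ii) among the
  eigenvectors of \<open>p(A)\<close> for \<open>\<mu>\<close>; as the eigenvalue belonging to a nonzero vector is unique,
  \<open>\<alpha>\<^sub>i\<close> and \<open>p(\<alpha>)\<close> then have the prescribed values.

  In both cases the search takes place in the eigencone of a matrix that commutes with every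
  \<open>A\<^sub>j\<close>. This is a nonzero closed set of nonnegative vectors, stable under componentwise maximum,
  under nonnegative scaling and under every \<open>A\<^sub>j\<close>. The key result
  (\<open>ex_eigenvector_closed_max_cone\<close>) is that a continuous max-linear map \<open>f\<close> of such a cone \<open>C\<close>
  into itself, with \<open>C\<close> nonzero, has an eigenvector in \<open>C\<close>. Intersecting with the eigencone found
  and passing to the next matrix yields a common eigenvector (\<open>ex_common_eigenvector\<close>).

  For the key result, consider the numbers \<open>t \<ge> 0\<close> with \<open>f x \<le> t x\<close> for some nonzero \<open>x\<close> in \<open>C\<close>.
  Some such \<open>t\<close> exists, because an \<open>x\<close> of maximal support will do, and by compactness of the
  unit sphere of \<open>C\<close> there is a least one. If it is 0, then \<open>f x = 0\<close>. Otherwise rescale \<open>f\<close> so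
  that it is 1. The iterates \<open>f\<^sup>k x\<close> then decrease to a fixed point of \<open>f\<close> in \<open>C\<close>, and it only
  remains to exclude that they tend to 0. In that case some iterate is at most \<open>x/2\<close>, and a
  finite geometric combination of iterates is a nonzero \<open>z\<close> in \<open>C\<close> with \<open>f z \<le> s z\<close> for some
  \<open>s < 1\<close> (\<open>ex_strict_subeigenvector\<close>), which contradicts minimality.
\<close>

section \<open>Maxima over finite index sets\<close>

lemma MAX_le_iff:
  fixes g :: "'k::finite \<Rightarrow> real"
  shows "(MAX k. g k) \<le> c \<longleftrightarrow> (\<forall>k. g k \<le> c)"
  by (subst Max_le_iff) auto

lemma mult_MAX_le_iff:
  fixes g :: "'k::finite \<Rightarrow> real"
  assumes "0 \<le> a"
  shows "a * (MAX k. g k) \<le> c \<longleftrightarrow> (\<forall>k. a * g k \<le> c)"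
proof -
  have "a * (MAX k. g k) = Max ((\<lambda>y. a * y) ` range g)"
    using assms by (intro mono_Max_commute) (auto intro!: monoI mult_left_mono)
  then show ?thesis
    by (simp add: image_image MAX_le_iff)
qed

lemma MAX_mult_le_iff:
  fixes g :: "'k::finite \<Rightarrow> real"
  assumes "0 \<le> a"
  shows "(MAX k. g k) * a \<le> c \<longleftrightarrow> (\<forall>k. g k * a \<le> c)"
  using mult_MAX_le_iff[OF assms, of g c] by (simp add: mult.commute)

lemma MAX_nonneg:
  fixes g :: "'k::finite \<Rightarrow> real"
  assumes "\<And>k. 0 \<le> g k"
  shows "0 \<le> (MAX k. g k)"
  using assms by (subst Max_ge_iff) auto

lemma max_sum_le_iff:
  assumes "finite S"
  shows "max_sum g S \<le> c \<longleftrightarrow> 0 \<le> c \<and> (\<forall>m\<in>S. g m \<le> c)"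
  using assms by (simp add: max_sum_def)

lemma max_sum_nonneg: "finite S \<Longrightarrow> 0 \<le> max_sum g S"
  by (simp add: max_sum_def)

lemma mult_max_sum:
  assumes "finite S" "0 \<le> a"
  shows "a * max_sum g S = max_sum (\<lambda>m. a * g m) S"
proof -
  have "a * max_sum g S = Max ((\<lambda>y. a * y) ` insert 0 (g ` S))"
    unfolding max_sum_def
    using assms by (intro mono_Max_commute) (auto intro!: monoI mult_left_mono)
  then show ?thesis
    by (simp add: max_sum_def image_image)
qed

lemma mult_max_sum_le_iff:
  assumes "finite S" "0 \<le> a"
  shows "a * max_sum g S \<le> c \<longleftrightarrow> 0 \<le> c \<and> (\<forall>m\<in>S. a * g m \<le> c)"
  using assms by (simp add: mult_max_sum max_sum_le_iff)

lemma max_sum_mult_le_iff: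
  assumes "finite S" "0 \<le> a"
  shows "max_sum g S * a \<le> c \<longleftrightarrow> 0 \<le> c \<and> (\<forall>m\<in>S. g m * a \<le> c)"
  using mult_max_sum_le_iff[OF assms, of g c] by (simp add: mult.commute)

text \<open>
  Comparing the upper bounds of both sides turns an identity between nested maxima into an
  exchange of universal quantifiers.
\<close>

lemma eq_by_upper_bounds:
  fixes x y :: real
  assumes "\<And>c. x \<le> c \<longleftrightarrow> y \<le> c"
  shows "x = y"
  using assms[of x] assms[of y] by (metis order.eq_iff)

lemma continuous_on_MAX:
  fixes g :: "'k \<Rightarrow> 'b::topological_space \<Rightarrow> real"
  assumes "finite K" "K \<noteq> {}" "\<And>k. k \<in> K \<Longrightarrow> continuous_on S (g k)"
  shows "continuous_on S (\<lambda>x. MAX k\<in>K. g k x)"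
  using assms
proof (induction K rule: finite_ne_induct)
  case (singleton k)
  then show ?case by simp
next
  case (insert k K)
  then show ?case by (simp add: continuous_on_max)
qed

section \<open>Max-algebraic products of nonnegative matrices\<close>

lemma nonneg_vector_iff: "nonneg_vector v \<longleftrightarrow> 0 \<le> v"
  by (simp add: nonneg_vector_def less_eq_vec_def)

lemma nonneg_matrix_vector_mult:
  assumes "nonneg_matrix A" "0 \<le> v"
  shows "0 \<le> A \<otimes>\<^sub>v v"
  using assms
  by (auto simp: less_eq_vec_def max_matrix_vector_mult_def nonneg_matrix_def intro!: MAX_nonneg)

lemma nonneg_matrix_mult:
  assumes "nonneg_matrix A" "nonneg_matrix B"
  shows "nonneg_matrix (A \<otimes>\<^sub>m B)"
  using assms by (auto simp: max_matrix_mult_def nonneg_matrix_def intro!: MAX_nonneg)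

lemma nonneg_mat_1: "nonneg_matrix (mat 1)"
  by (simp add: nonneg_matrix_def mat_def)

lemma max_matrix_mult_assoc:
  assumes "nonneg_matrix A" "nonneg_matrix C"
  shows "(A \<otimes>\<^sub>m B) \<otimes>\<^sub>m C = A \<otimes>\<^sub>m (B \<otimes>\<^sub>m C)"
proof -
  have A: "0 \<le> A $ i $ j" and C: "0 \<le> C $ k $ l" for i j k l
    using assms by (auto simp: nonneg_matrix_def)
  have "((A \<otimes>\<^sub>m B) \<otimes>\<^sub>m C) $ i $ j = (A \<otimes>\<^sub>m (B \<otimes>\<^sub>m C)) $ i $ j" for i j
    by (rule eq_by_upper_bounds)
      (simp add: max_matrix_mult_def MAX_le_iff MAX_mult_le_iff[OF C] mult_MAX_le_iff[OF A]
        mult.assoc, blast)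
  then show ?thesis by (simp add: vec_eq_iff)
qed

lemma max_matrix_vector_mult_assoc:
  assumes "nonneg_matrix A" "0 \<le> v"
  shows "(A \<otimes>\<^sub>m B) \<otimes>\<^sub>v v = A \<otimes>\<^sub>v (B \<otimes>\<^sub>v v)"
proof -
  have A: "0 \<le> A $ i $ j" and v: "0 \<le> v $ k" for i j k
    using assms by (auto simp: nonneg_matrix_def less_eq_vec_def)
  have "((A \<otimes>\<^sub>m B) \<otimes>\<^sub>v v) $ i = (A \<otimes>\<^sub>v (B \<otimes>\<^sub>v v)) $ i" for i
    by (rule eq_by_upper_bounds)
      (simp add: max_matrix_mult_def max_matrix_vector_mult_def MAX_le_iff MAX_mult_le_iff[OF v]
        mult_MAX_le_iff[OF A] mult.assoc, blast)
  then show ?thesis by (simp add: vec_eq_iff)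
qed

lemma MAX_single:
  fixes g :: "'k::finite \<Rightarrow> real"
  assumes "g i = c" "0 \<le> c" "\<And>k. k \<noteq> i \<Longrightarrow> g k = 0"
  shows "(MAX k. g k) = c"
proof (rule Max_eqI)
  show "y \<le> c" if "y \<in> range g" for y
  proof -
    from that obtain k where "y = g k" by blast
    with assms show ?thesis by (cases "k = i") auto
  qed
  show "c \<in> range g" using assms(1) by blast
qed simp

lemma max_matrix_mult_1_left:
  assumes "nonneg_matrix A"
  shows "mat 1 \<otimes>\<^sub>m A = A"
proof -
  have "(MAX k. mat 1 $ i $ k * A $ k $ j) = A $ i $ j" for i j
    by (rule MAX_single[where i = i]) (use assms in \<open>auto simp: mat_def nonneg_matrix_def\<close>)
  then show ?thesis by (simp add: max_matrix_mult_def vec_eq_iff)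
qed

lemma max_matrix_mult_1_right:
  assumes "nonneg_matrix A"
  shows "A \<otimes>\<^sub>m mat 1 = A"
proof -
  have "(MAX k. A $ i $ k * mat 1 $ k $ j) = A $ i $ j" for i j
    by (rule MAX_single[where i = j]) (use assms in \<open>auto simp: mat_def nonneg_matrix_def\<close>)
  then show ?thesis by (simp add: max_matrix_mult_def vec_eq_iff)
qed

lemma max_matrix_vector_mult_1:
  assumes "0 \<le> v"
  shows "mat 1 \<otimes>\<^sub>v v = v"
proof -
  have "(MAX k. mat 1 $ i $ k * v $ k) = v $ i" for i
    by (rule MAX_single[where i = i]) (use assms in \<open>auto simp: mat_def less_eq_vec_def\<close>)
  then show ?thesis by (simp add: max_matrix_vector_mult_def vec_eq_iff)
qed

lemma mult_sup_right:
  fixes a x y :: real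
  assumes "0 \<le> a"
  shows "a * sup x y = sup (a * x) (a * y)"
  using assms by (auto simp: sup_real_def max_def mult_left_mono antisym)

lemma scaleR_sup:
  fixes u v :: "real^'n"
  assumes "0 \<le> a"
  shows "a *\<^sub>R sup u v = sup (a *\<^sub>R u) (a *\<^sub>R v)"
  using assms by (simp add: vec_eq_iff sup_vec_def mult_sup_right)

lemma max_matrix_vector_mult_scaleR:
  assumes "0 \<le> c"
  shows "A \<otimes>\<^sub>v (c *\<^sub>R v) = c *\<^sub>R (A \<otimes>\<^sub>v v)"
proof -
  have "(A \<otimes>\<^sub>v (c *\<^sub>R v)) $ i = (c *\<^sub>R (A \<otimes>\<^sub>v v)) $ i" for i
    using assms
    by (intro eq_by_upper_bounds)
      (simp add: max_matrix_vector_mult_def MAX_le_iff mult_MAX_le_iff mult.left_commute)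
  then show ?thesis by (simp add: vec_eq_iff)
qed

lemma max_matrix_vector_mult_sup:
  assumes "nonneg_matrix A"
  shows "A \<otimes>\<^sub>v sup v w = sup (A \<otimes>\<^sub>v v) (A \<otimes>\<^sub>v w)"
proof -
  have "(A \<otimes>\<^sub>v sup v w) $ i = sup (A \<otimes>\<^sub>v v) (A \<otimes>\<^sub>v w) $ i" for i
    using assms
    by (intro eq_by_upper_bounds)
      (auto simp: max_matrix_vector_mult_def nonneg_matrix_def sup_vec_def MAX_le_iff
        mult_sup_right)
  then show ?thesis by (simp add: vec_eq_iff)
qed

lemma continuous_on_max_matrix_vector_mult: "continuous_on S (\<lambda>v. A \<otimes>\<^sub>v v)"
  unfolding max_matrix_vector_mult_def
  by (intro continuous_on_vec_lambda continuous_on_MAX continuous_intros) auto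

section \<open>Eigenvectors of max-linear maps on closed max cones\<close>

definition closed_max_cone :: "(real^'n) set \<Rightarrow> bool" where
  "closed_max_cone C \<longleftrightarrow> closed C \<and> (\<forall>x\<in>C. 0 \<le> x) \<and>
     (\<forall>x\<in>C. \<forall>y\<in>C. sup x y \<in> C) \<and> (\<forall>x\<in>C. \<forall>c\<ge>0. c *\<^sub>R x \<in> C)"

definition max_endomorphism :: "(real^'n) set \<Rightarrow> (real^'n \<Rightarrow> real^'n) \<Rightarrow> bool" where
  "max_endomorphism C f \<longleftrightarrow> f ` C \<subseteq> C \<and> continuous_on C f \<and>
     (\<forall>x\<in>C. \<forall>y\<in>C. f (sup x y) = sup (f x) (f y)) \<and> (\<forall>x\<in>C. \<forall>c\<ge>0. f (c *\<^sub>R x) = c *\<^sub>R f x)"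

lemma max_endomorphism_mono:
  assumes "max_endomorphism C f" "x \<in> C" "y \<in> C" "x \<le> y"
  shows "f x \<le> f y"
proof -
  have "f y = sup (f x) (f y)"
    using assms by (metis max_endomorphism_def sup.absorb2)
  then show ?thesis by (metis sup.cobounded1)
qed

lemma max_endomorphism_scaleR:
  assumes "closed_max_cone C" "max_endomorphism C f" "0 \<le> a"
  shows "max_endomorphism C (\<lambda>x. a *\<^sub>R f x)"
  using assms unfolding max_endomorphism_def closed_max_cone_def
  by (auto intro!: continuous_intros simp: scaleR_sup mult.commute)

text \<open>
  A vector \<^term>\<open>z\<close> of maximal support in \<^term>\<open>C\<close> works: the support of
  \<^term>\<open>sup z (f z)\<close> cannot exceed that of \<^term>\<open>z\<close>, so \<^term>\<open>f z\<close> vanishes wherever \<^term>\<open>z\<close> does.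
\<close>

lemma ex_subeigenvector:
  fixes C :: "(real^'n) set"
  assumes C: "closed_max_cone C" and f: "max_endomorphism C f"
    and ne: "x \<in> C" "x \<noteq> 0"
  obtains t z where "0 \<le> t" "z \<in> C" "z \<noteq> 0" "f z \<le> t *\<^sub>R z"
proof -
  define supp where "supp = (\<lambda>z :: real^'n. {i. z $ i \<noteq> 0})"
  have "\<exists>z. z \<in> C \<and> (\<forall>y. y \<in> C \<longrightarrow> card (supp y) \<le> card (supp z))"
  proof (rule ex_has_greatest_nat)
    show "x \<in> C" by fact
    show "\<forall>y. y \<in> C \<longrightarrow> card (supp y) < Suc CARD('n)"
      by (simp add: card_mono less_Suc_eq_le)
  qed
  then obtain z where z: "z \<in> C" and max: "\<And>y. y \<in> C \<Longrightarrow> card (supp y) \<le> card (supp z)"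
    by blast
  have "card (supp x) \<noteq> 0"
    using ne(2) by (auto simp: supp_def vec_eq_iff)
  with max[OF ne(1)] have "z \<noteq> 0"
    by (auto simp: supp_def)
  have fz: "f z \<in> C" using f z by (auto simp: max_endomorphism_def)
  have z0: "0 \<le> z $ i" and fz0: "0 \<le> f z $ i" for i
    using C z fz by (auto simp: closed_max_cone_def less_eq_vec_def)
  have "sup z (f z) \<in> C" using C z fz by (auto simp: closed_max_cone_def)
  moreover have "supp z \<subseteq> supp (sup z (f z))"
  proof
    fix i assume "i \<in> supp z"
    with z0[of i] show "i \<in> supp (sup z (f z))"
      by (auto simp: supp_def sup_vec_def sup_real_def max_def)
  qed
  ultimately have eq: "supp z = supp (sup z (f z))"
    using max by (metis card_seteq finite)
  have zero: "f z $ i = 0" if "z $ i = 0" for i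
  proof -
    have "i \<notin> supp (sup z (f z))" using that eq by (auto simp: supp_def)
    with that fz0[of i] show ?thesis
      by (simp add: supp_def sup_vec_def sup_real_def max_def split: if_splits)
  qed
  define t where "t = (MAX i. f z $ i / z $ i)"
  have "f z $ i \<le> t * z $ i" for i
  proof (cases "z $ i = 0")
    case True
    with zero show ?thesis by simp
  next
    case False
    have "f z $ i / z $ i \<le> t" unfolding t_def by (rule Max_ge) auto
    with False z0[of i] show ?thesis by (simp add: field_simps)
  qed
  then have "f z \<le> t *\<^sub>R z" by (simp add: less_eq_vec_def)
  moreover have "0 \<le> t" unfolding t_def using z0 fz0 by (intro MAX_nonneg) simp
  ultimately show ?thesis using that z \<open>z \<noteq> 0\<close> by blast
qed

text \<open>
  By homogeneity only unit vectors matter, and bounding \<^term>\<open>t\<close> by one admissible value leaves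
  a compact set of pairs of a factor and a unit vector on which to minimise the factor.
\<close>

lemma ex_least_subeigenvalue:
  fixes C :: "(real^'n) set"
  assumes C: "closed_max_cone C" and f: "max_endomorphism C f"
    and ne: "x0 \<in> C" "x0 \<noteq> 0"
  obtains t x where "0 \<le> t" "x \<in> C" "x \<noteq> 0" "f x \<le> t *\<^sub>R x"
    and "\<And>s z. 0 \<le> s \<Longrightarrow> z \<in> C \<Longrightarrow> z \<noteq> 0 \<Longrightarrow> f z \<le> s *\<^sub>R z \<Longrightarrow> t \<le> s"
proof -
  obtain t0 z0 where t0: "0 \<le> t0" "z0 \<in> C" "z0 \<noteq> 0" "f z0 \<le> t0 *\<^sub>R z0"
    using ex_subeigenvector[OF C f ne] by blast
  define K where "K = {0..t0} \<times> (C \<inter> sphere 0 1)"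
  define S where "S = {q \<in> K. f (snd q) \<le> fst q *\<^sub>R snd q}"
  have clC: "closed C" using C by (simp add: closed_max_cone_def)
  have K: "compact K" unfolding K_def
    using clC by (intro compact_Times closed_Int_compact) auto
  have cont: "continuous_on K (\<lambda>q. f (snd q))"
    using f by (intro continuous_on_compose2[of C f K snd] continuous_intros)
      (auto simp: K_def max_endomorphism_def)
  have "S = (\<Inter>i. {q \<in> K. f (snd q) $ i \<le> fst q * snd q $ i})"
    by (auto simp: S_def less_eq_vec_def)
  moreover have "closed {q \<in> K. f (snd q) $ i \<le> fst q * snd q $ i}" for i
    by (intro continuous_on_closed_Collect_le continuous_intros cont compact_imp_closed K)
  ultimately have "closed S" by auto
  have "compact S"
    using compact_Int_closed[OF K \<open>closed S\<close>] by (simp add: S_def Int_absorb1 subset_eq Collect_conj_eq)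
  have normalise: "(s, (1 / norm z) *\<^sub>R z) \<in> S"
    if "0 \<le> s" "s \<le> t0" "z \<in> C" "z \<noteq> 0" "f z \<le> s *\<^sub>R z" for s z
  proof -
    have "f ((1 / norm z) *\<^sub>R z) = (1 / norm z) *\<^sub>R f z"
      using f that(3) by (simp add: max_endomorphism_def)
    also have "\<dots> \<le> (1 / norm z) *\<^sub>R (s *\<^sub>R z)"
      using that by (intro scaleR_left_mono) auto
    finally show ?thesis
      using that C by (simp add: S_def K_def closed_max_cone_def mult.commute)
  qed
  have "S \<noteq> {}" using normalise[of t0 z0] t0 by auto
  then obtain q where q: "q \<in> S" and min: "\<And>q'. q' \<in> S \<Longrightarrow> fst q \<le> fst q'"
    using continuous_attains_inf[OF \<open>compact S\<close> _ continuous_on_fst[OF continuous_on_id]] by auto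
  show ?thesis
  proof (rule that[of "fst q" "snd q"])
    show "0 \<le> fst q" "snd q \<in> C" "snd q \<noteq> 0" "f (snd q) \<le> fst q *\<^sub>R snd q"
      using q by (auto simp: S_def K_def)
    show "fst q \<le> s" if "0 \<le> s" "z \<in> C" "z \<noteq> 0" "f z \<le> s *\<^sub>R z" for s z
    proof (cases "s \<le> t0")
      case True
      with normalise that min show ?thesis by fastforce
    next
      case False
      with q show ?thesis by (auto simp: S_def K_def)
    qed
  qed
qed

lemma funpow_mem:
  assumes "f ` C \<subseteq> C" "x \<in> C"
  shows "(f ^^ k) x \<in> C"
  using assms by (induction k) auto

text \<open>
  Coordinatewise, \<open>f\<^sup>k x \<le> x/2\<close> for some positive \<open>k\<close>: outside the support of \<^term>\<open>x\<close> the
  iterates vanish, and inside it they tend to 0. Put \<open>u = 2\<^bsup>1/k\<^esup>\<close>, so that \<open>u\<^sup>k f\<^sup>k x \<le> x\<close>. Then the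
  maximum \<open>z\<close> of \<open>u\<^sup>j f\<^sup>j x\<close> over \<open>j < k\<close> satisfies \<open>u f z \<le> z\<close>, since applying \<open>u f\<close> shifts the
  terms and the new last one is absorbed by \<open>x\<close>.
\<close>

lemma ex_strict_subeigenvector:
  fixes C :: "(real^'n) set"
  assumes C: "closed_max_cone C" and f: "max_endomorphism C f"
    and x: "x \<in> C" "x \<noteq> 0" and le: "f x \<le> x"
    and lim: "(\<lambda>k. (f ^^ k) x) \<longlonglongrightarrow> 0"
  obtains s z where "0 \<le> s" "s < 1" "z \<in> C" "z \<noteq> 0" "f z \<le> s *\<^sub>R z"
proof -
  have fC: "f ` C \<subseteq> C" using f by (simp add: max_endomorphism_def)
  have x0: "0 \<le> x $ i" for i using C x by (auto simp: closed_max_cone_def less_eq_vec_def)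
  have pow_le: "(f ^^ k) x \<le> x" for k
  proof (induction k)
    case (Suc k)
    then have "f ((f ^^ k) x) \<le> f x"
      using max_endomorphism_mono[OF f] funpow_mem[OF fC x(1)] x(1) by blast
    with le show ?case by simp
  qed simp
  have "\<forall>\<^sub>F k in sequentially. (f ^^ k) x $ i \<le> x $ i / 2" for i
  proof (cases "x $ i = 0")
    case True
    then show ?thesis using pow_le by (auto simp: less_eq_vec_def intro!: always_eventually) metis
  next
    case False
    with x0[of i] have "0 < x $ i / 2" by simp
    moreover have "(\<lambda>k. (f ^^ k) x $ i) \<longlonglongrightarrow> 0"
      using tendsto_vec_nth[OF lim, of i] by simp
    ultimately have "\<forall>\<^sub>F k in sequentially. (f ^^ k) x $ i < x $ i / 2"
      by (rule order_tendstoD(2)[rotated])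
    then show ?thesis by (rule eventually_mono) simp
  qed
  then have "\<forall>\<^sub>F k in sequentially. \<forall>i. (f ^^ k) x $ i \<le> x $ i / 2"
    by (rule eventually_all_finite)
  then obtain k where k: "\<And>j. j \<ge> k \<Longrightarrow> \<forall>i. (f ^^ j) x $ i \<le> x $ i / 2"
    by (auto simp: eventually_sequentially)
  have half: "(f ^^ Suc k) x \<le> (1/2) *\<^sub>R x"
    using k[of "Suc k"] by (simp add: less_eq_vec_def)
  define s where "s = root (Suc k) (1/2)"
  have s: "0 < s" "s < 1" "s ^ Suc k = 1/2"
    unfolding s_def by (simp_all add: real_root_pow_pos2 del: power_Suc)
  define u where "u = inverse s"
  have u: "0 < u" "u ^ Suc k = 2" using s unfolding u_def by (simp_all only: power_inverse) simp_all
  \<comment> \<open>\<open>z j\<close> is the maximum of \<open>u\<^sup>i f\<^sup>i x\<close> over \<open>i \<le> j\<close>. This recursion adds a term at the front,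
    while \<open>step\<close> below shows that the same vector arises by adding a term at the end.\<close>
  define z where "z = rec_nat x (\<lambda>_ w. sup x (u *\<^sub>R f w))"
  have z_0: "z 0 = x" and z_Suc: "z (Suc j) = sup x (u *\<^sub>R f (z j))" for j
    by (simp_all add: z_def)
  have zC: "z j \<in> C" for j
    using C fC x u by (induction j) (auto simp: z_0 z_Suc closed_max_cone_def)
  have uf: "max_endomorphism C (\<lambda>w. u *\<^sub>R f w)"
    using C f u by (intro max_endomorphism_scaleR) auto
  have powC: "u ^ j *\<^sub>R (f ^^ j) x \<in> C" for j
    using funpow_mem[OF fC x(1)] C u by (auto simp: closed_max_cone_def)
  have step: "z (Suc j) = sup (z j) (u ^ Suc j *\<^sub>R (f ^^ Suc j) x)" for j
  proof (induction j)
    case 0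
    show ?case by (simp add: z_0 z_Suc)
  next
    case (Suc j)
    have hom: "f (u ^ Suc j *\<^sub>R (f ^^ Suc j) x) = u ^ Suc j *\<^sub>R (f ^^ Suc (Suc j)) x"
      using f funpow_mem[OF fC x(1), of "Suc j"] u by (simp add: max_endomorphism_def)
    have "z (Suc (Suc j)) = sup x (u *\<^sub>R f (sup (z j) (u ^ Suc j *\<^sub>R (f ^^ Suc j) x)))"
      using Suc by (simp add: z_Suc[of "Suc j"])
    also have "\<dots> = sup x (sup (u *\<^sub>R f (z j)) (u *\<^sub>R f (u ^ Suc j *\<^sub>R (f ^^ Suc j) x)))"
      using uf zC powC by (simp add: max_endomorphism_def del: power_Suc funpow.simps)
    also have "\<dots> = sup (z (Suc j)) (u ^ Suc (Suc j) *\<^sub>R (f ^^ Suc (Suc j)) x)"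
      unfolding hom by (simp add: z_Suc sup.assoc)
    finally show ?case .
  qed
  have le_z: "x \<le> z j" for j
    by (cases j) (simp_all add: z_0 z_Suc)
  have "u ^ Suc k *\<^sub>R (f ^^ Suc k) x \<le> x"
    using scaleR_left_mono[OF half, of 2] unfolding u by simp
  then have "u ^ Suc k *\<^sub>R (f ^^ Suc k) x \<le> z k"
    using le_z order_trans by blast
  then have "z (Suc k) = z k"
    unfolding step by (rule sup.absorb1)
  then have "u *\<^sub>R f (z k) \<le> z k" by (metis z_Suc sup.cobounded2)
  then have "s *\<^sub>R (u *\<^sub>R f (z k)) \<le> s *\<^sub>R z k"
    using s by (intro scaleR_left_mono) auto
  then have "f (z k) \<le> s *\<^sub>R z k" using s by (simp add: u_def)
  moreover have "z k \<noteq> 0"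
  proof
    assume "z k = 0"
    with le_z[of k] x0 have "x = 0" by (auto simp: vec_eq_iff less_eq_vec_def intro!: antisym)
    with x show False by simp
  qed
  ultimately show ?thesis using that[of s "z k"] s zC by auto
qed

text \<open>
  The least factor \<^term>\<open>t\<close> with \<^term>\<open>f x \<le> t *\<^sub>R x\<close> for a nonzero \<^term>\<open>x\<close> in \<^term>\<open>C\<close> is an
  eigenvalue. The vector \<^term>\<open>x\<close> itself need not be an eigenvector, but for positive \<^term>\<open>t\<close>
  the limit of the decreasing iterates of \<^term>\<open>(1 / t) *\<^sub>R f x\<close> is one.
\<close>

theorem ex_eigenvector_closed_max_cone:
  fixes C :: "(real^'n) set"
  assumes C: "closed_max_cone C" and f: "max_endomorphism C f"
    and ne: "x0 \<in> C" "x0 \<noteq> 0"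
  obtains t x where "0 \<le> t" "x \<in> C" "x \<noteq> 0" "f x = t *\<^sub>R x"
proof -
  obtain t x where t: "0 \<le> t" "x \<in> C" "x \<noteq> 0" "f x \<le> t *\<^sub>R x"
    and min: "\<And>s z. 0 \<le> s \<Longrightarrow> z \<in> C \<Longrightarrow> z \<noteq> 0 \<Longrightarrow> f z \<le> s *\<^sub>R z \<Longrightarrow> t \<le> s"
    using ex_least_subeigenvalue[OF C f ne] by blast
  have fx: "f x \<in> C" using f t by (auto simp: max_endomorphism_def)
  show ?thesis
  proof (cases "t = 0")
    case True
    have "0 \<le> f x" using C fx by (auto simp: closed_max_cone_def)
    with True t have "f x = t *\<^sub>R x" by (auto intro: antisym)
    with t that show ?thesis by blast
  next
    case False
    define g where "g = (\<lambda>w. (1 / t) *\<^sub>R f w)"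
    have g: "max_endomorphism C g"
      unfolding g_def using C f t by (intro max_endomorphism_scaleR) auto
    have gC: "g ` C \<subseteq> C" using g by (simp add: max_endomorphism_def)
    have fg: "f w = t *\<^sub>R g w" for w using False by (simp add: g_def)
    have "(1 / t) *\<^sub>R f x \<le> (1 / t) *\<^sub>R (t *\<^sub>R x)"
      using t by (intro scaleR_left_mono) auto
    then have gx: "g x \<le> x" using False by (simp add: g_def)
    have powC: "(g ^^ k) x \<in> C" for k using funpow_mem[OF gC t(2)] .
    have dec: "(g ^^ Suc k) x \<le> (g ^^ k) x" for k
    proof (induction k)
      case (Suc k)
      then show ?case using max_endomorphism_mono[OF g powC powC, of "Suc k" k] by simp
    qed (simp add: gx)
    have "\<exists>l. (\<lambda>k. (g ^^ k) x $ i) \<longlonglongrightarrow> l" for i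
    proof -
      have "decseq (\<lambda>k. (g ^^ k) x $ i)"
        using dec unfolding decseq_Suc_iff less_eq_vec_def by blast
      moreover have "\<forall>k. 0 \<le> (g ^^ k) x $ i"
        using powC C by (auto simp: closed_max_cone_def less_eq_vec_def)
      ultimately show ?thesis
        by (metis decseq_convergent)
    qed
    then obtain l where l: "\<And>i. (\<lambda>k. (g ^^ k) x $ i) \<longlonglongrightarrow> l i" by metis
    define y where "y = (\<chi> i. l i)"
    have lim: "(\<lambda>k. (g ^^ k) x) \<longlonglongrightarrow> y"
      using l by (intro vec_tendstoI) (simp add: y_def)
    have yC: "y \<in> C"
      using C closed_sequentially[OF _ powC lim] by (auto simp: closed_max_cone_def)
    have "(\<lambda>k. g ((g ^^ k) x)) \<longlonglongrightarrow> g y"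
      using g lim yC powC
      by (intro continuous_on_tendsto_compose[of C g]) (auto simp: max_endomorphism_def)
    moreover have "(\<lambda>k. g ((g ^^ k) x)) \<longlonglongrightarrow> y"
      using LIMSEQ_Suc[OF lim] by simp
    ultimately have gy: "g y = y" using LIMSEQ_unique by blast
    have "y \<noteq> 0"
    proof
      assume "y = 0"
      with lim have "(\<lambda>k. (g ^^ k) x) \<longlonglongrightarrow> 0" by simp
      then obtain s z where s: "0 \<le> s" "s < 1" "z \<in> C" "z \<noteq> 0" "g z \<le> s *\<^sub>R z"
        using ex_strict_subeigenvector[OF C g t(2,3) gx] by blast
      have "t *\<^sub>R g z \<le> t *\<^sub>R (s *\<^sub>R z)" using s t by (intro scaleR_left_mono) auto
      then have "f z \<le> (t * s) *\<^sub>R z" by (simp add: fg)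
      then have "t \<le> t * s" using min[of "t * s" z] s t by simp
      with False t s show False by (simp add: mult_le_cancel_left1)
    qed
    with that[of t y] t yC fg[of y] gy show ?thesis by simp
  qed
qed

section \<open>Common eigenvectors of commuting matrices\<close>

definition eigencone :: "real^'n^'n \<Rightarrow> real \<Rightarrow> (real^'n) set" where
  "eigencone A \<alpha> = {v. 0 \<le> v \<and> A \<otimes>\<^sub>v v = \<alpha> *\<^sub>R v}"

lemma max_eigenvalues_iff: "\<alpha> \<in> \<Lambda> A \<longleftrightarrow> 0 \<le> \<alpha> \<and> (\<exists>v \<in> eigencone A \<alpha>. v \<noteq> 0)"
  by (auto simp: max_eigenvalues_def eigencone_def nonneg_vector_iff)

lemma closed_max_cone_eigencone:
  assumes "nonneg_matrix A" "0 \<le> \<alpha>"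
  shows "closed_max_cone (eigencone A \<alpha>)"
proof -
  have "eigencone A \<alpha> = {v. 0 \<le> v} \<inter> {v. A \<otimes>\<^sub>v v = \<alpha> *\<^sub>R v}"
    by (auto simp: eigencone_def)
  moreover have "{v. 0 \<le> v} = (\<Inter>i. {v :: real^'a. 0 \<le> v $ i})"
    by (auto simp: less_eq_vec_def)
  moreover have "closed (\<Inter>i. {v :: real^'a. 0 \<le> v $ i})"
    by (intro closed_INT ballI closed_Collect_le continuous_intros)
  moreover have "closed {v. A \<otimes>\<^sub>v v = \<alpha> *\<^sub>R v}"
    by (intro closed_Collect_eq continuous_on_max_matrix_vector_mult continuous_intros)
  ultimately have "closed (eigencone A \<alpha>)" by auto
  then show ?thesis
    using assms
    by (auto simp: closed_max_cone_def eigencone_def max_matrix_vector_mult_sup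
        max_matrix_vector_mult_scaleR scaleR_sup mult.commute le_supI1 scaleR_nonneg_nonneg)
qed

lemma closed_max_cone_Int:
  "closed_max_cone C \<Longrightarrow> closed_max_cone D \<Longrightarrow> closed_max_cone (C \<inter> D)"
  by (auto simp: closed_max_cone_def)

lemma eigencone_invariant:
  assumes "nonneg_matrix A" "nonneg_matrix B" "A \<otimes>\<^sub>m B = B \<otimes>\<^sub>m A" "0 \<le> \<alpha>"
    and v: "v \<in> eigencone A \<alpha>"
  shows "B \<otimes>\<^sub>v v \<in> eigencone A \<alpha>"
proof -
  have v0: "0 \<le> v" "A \<otimes>\<^sub>v v = \<alpha> *\<^sub>R v" using v by (auto simp: eigencone_def)
  have "A \<otimes>\<^sub>v (B \<otimes>\<^sub>v v) = B \<otimes>\<^sub>v (A \<otimes>\<^sub>v v)"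
    using assms v0 by (metis max_matrix_vector_mult_assoc)
  with v0 assms show ?thesis
    by (auto simp: eigencone_def max_matrix_vector_mult_scaleR nonneg_matrix_vector_mult)
qed

lemma max_endomorphism_matrix:
  assumes "nonneg_matrix A" "\<And>v. v \<in> C \<Longrightarrow> A \<otimes>\<^sub>v v \<in> C"
  shows "max_endomorphism C (\<lambda>v. A \<otimes>\<^sub>v v)"
  using assms
  by (auto simp: max_endomorphism_def max_matrix_vector_mult_sup max_matrix_vector_mult_scaleR
      continuous_on_max_matrix_vector_mult)

text \<open>
  An eigenvector of one of the matrices is found in \<^term>\<open>C\<close>, and \<^term>\<open>C\<close> is replaced by its
  intersection with the corresponding eigencone; the remaining matrices preserve that
  intersection because they commute with the first one. The cone has to vary in the induction.
\<close>

lemma ex_common_eigenvector: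
  fixes A :: "'b \<Rightarrow> real^'n^'n"
  assumes "finite J"
    and "\<And>j. j \<in> J \<Longrightarrow> nonneg_matrix (A j)"
    and "\<And>i j. i \<in> J \<Longrightarrow> j \<in> J \<Longrightarrow> A i \<otimes>\<^sub>m A j = A j \<otimes>\<^sub>m A i"
    and "closed_max_cone C" "x \<in> C" "x \<noteq> 0"
    and "\<And>j v. j \<in> J \<Longrightarrow> v \<in> C \<Longrightarrow> A j \<otimes>\<^sub>v v \<in> C"
  shows "\<exists>v \<alpha>. v \<in> C \<and> v \<noteq> 0 \<and> (\<forall>j\<in>J. 0 \<le> \<alpha> j \<and> v \<in> eigencone (A j) (\<alpha> j))"
  using assms
proof (induction J arbitrary: C x rule: finite_induct)
  case empty
  then show ?case by auto
next
  case (insert j J)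
  have f: "max_endomorphism C (\<lambda>v. A j \<otimes>\<^sub>v v)"
    using insert.prems by (intro max_endomorphism_matrix) auto
  obtain t w where w: "0 \<le> t" "w \<in> C" "w \<noteq> 0" "A j \<otimes>\<^sub>v w = t *\<^sub>R w"
    using ex_eigenvector_closed_max_cone[OF insert.prems(3) f insert.prems(4,5)] by blast
  have "0 \<le> w" using w insert.prems(3) by (auto simp: closed_max_cone_def)
  have "\<exists>v \<alpha>. v \<in> C \<inter> eigencone (A j) t \<and> v \<noteq> 0 \<and>
      (\<forall>j\<in>J. 0 \<le> \<alpha> j \<and> v \<in> eigencone (A j) (\<alpha> j))"
  proof (rule insert.IH)
    show "closed_max_cone (C \<inter> eigencone (A j) t)"
      using insert.prems w by (intro closed_max_cone_Int closed_max_cone_eigencone) auto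
    show "w \<in> C \<inter> eigencone (A j) t" "w \<noteq> 0"
      using w \<open>0 \<le> w\<close> by (auto simp: eigencone_def)
    show "A i \<otimes>\<^sub>v v \<in> C \<inter> eigencone (A j) t" if "i \<in> J" "v \<in> C \<inter> eigencone (A j) t" for i v
      using that insert.prems w eigencone_invariant[of "A j" "A i" t v] by auto
  qed (use insert.prems in auto)
  then obtain v \<alpha> where v: "v \<in> C" "v \<in> eigencone (A j) t" "v \<noteq> 0"
      "\<forall>j\<in>J. 0 \<le> \<alpha> j \<and> v \<in> eigencone (A j) (\<alpha> j)" by blast
  have "\<forall>i\<in>insert j J. 0 \<le> (\<alpha>(j := t)) i \<and> v \<in> eigencone (A i) ((\<alpha>(j := t)) i)"
    using v w insert.hyps by auto
  with v show ?case by blast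
qed

section \<open>Max polynomials of matrices\<close>

lemma nonneg_max_matrix_power: "nonneg_matrix A \<Longrightarrow> nonneg_matrix (max_matrix_power A k)"
  by (induction k) (auto simp: nonneg_mat_1 nonneg_matrix_mult)

lemma max_matrix_power_vector_eigen:
  assumes "nonneg_matrix A" "0 \<le> \<alpha>" "v \<in> eigencone A \<alpha>"
  shows "max_matrix_power A k \<otimes>\<^sub>v v = \<alpha> ^ k *\<^sub>R v"
  using assms
  by (induction k)
    (auto simp: eigencone_def max_matrix_vector_mult_1 max_matrix_vector_mult_assoc
      max_matrix_vector_mult_scaleR mult.commute)

lemma commute_mult:
  assumes "nonneg_matrix A" "nonneg_matrix M" "nonneg_matrix N"
    and "A \<otimes>\<^sub>m M = M \<otimes>\<^sub>m A" "A \<otimes>\<^sub>m N = N \<otimes>\<^sub>m A"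
  shows "A \<otimes>\<^sub>m (M \<otimes>\<^sub>m N) = (M \<otimes>\<^sub>m N) \<otimes>\<^sub>m A"
  using assms by (metis max_matrix_mult_assoc)

lemma commute_power:
  assumes "nonneg_matrix A" "nonneg_matrix B" "A \<otimes>\<^sub>m B = B \<otimes>\<^sub>m A"
  shows "A \<otimes>\<^sub>m max_matrix_power B k = max_matrix_power B k \<otimes>\<^sub>m A"
  using assms
  by (induction k)
    (auto simp: max_matrix_mult_1_left max_matrix_mult_1_right intro!: commute_mult
      nonneg_max_matrix_power)

text \<open>
  Monomials over an arbitrary list of variables, so that induction on the list is possible.
\<close>

abbreviation max_power_product ::
    "(nat \<Rightarrow> real^'n^'n) \<Rightarrow> (nat \<Rightarrow> nat) \<Rightarrow> nat list \<Rightarrow> real^'n^'n" where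
  "max_power_product A e xs \<equiv> foldr (\<lambda>i M. max_matrix_power (A i) (e i) \<otimes>\<^sub>m M) xs (mat 1)"

lemma nonneg_max_power_product:
  assumes "\<And>i. i \<in> set xs \<Longrightarrow> nonneg_matrix (A i)"
  shows "nonneg_matrix (max_power_product A e xs)"
  using assms
  by (induction xs) (auto simp: nonneg_mat_1 nonneg_matrix_mult nonneg_max_matrix_power)

lemma commute_max_power_product:
  assumes "nonneg_matrix B" "\<And>i. i \<in> set xs \<Longrightarrow> nonneg_matrix (A i)"
    and "\<And>i. i \<in> set xs \<Longrightarrow> B \<otimes>\<^sub>m A i = A i \<otimes>\<^sub>m B"
  shows "B \<otimes>\<^sub>m max_power_product A e xs = max_power_product A e xs \<otimes>\<^sub>m B"
  using assms
  by (induction xs)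
    (auto simp: max_matrix_mult_1_left max_matrix_mult_1_right intro!: commute_mult
      nonneg_max_matrix_power nonneg_max_power_product commute_power)

lemma max_power_product_vector_eigen:
  assumes "\<And>i. i \<in> set xs \<Longrightarrow> nonneg_matrix (A i)" "0 \<le> v"
    and "\<And>i. i \<in> set xs \<Longrightarrow> 0 \<le> \<alpha> i \<and> v \<in> eigencone (A i) (\<alpha> i)"
  shows "max_power_product A e xs \<otimes>\<^sub>v v = prod_list (map (\<lambda>i. \<alpha> i ^ e i) xs) *\<^sub>R v"
  using assms
proof (induction xs)
  case Nil
  then show ?case by (simp add: max_matrix_vector_mult_1)
next
  case (Cons i xs)
  have "0 \<le> prod_list (map (\<lambda>i. \<alpha> i ^ e i) xs)"
    using Cons.prems by (intro prod_list_nonneg) auto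
  moreover have "max_matrix_power (A i) (e i) \<otimes>\<^sub>v v = \<alpha> i ^ e i *\<^sub>R v"
    using Cons.prems by (intro max_matrix_power_vector_eigen) auto
  ultimately show ?case using Cons
    by (simp add: max_matrix_vector_mult_assoc nonneg_max_matrix_power
        max_matrix_vector_mult_scaleR mult.commute)
qed

lemma max_matrix_monomial_vector_eigen:
  assumes "\<And>i. i \<in> {1..r} \<Longrightarrow> nonneg_matrix (A i)" "0 \<le> v"
    and "\<And>i. i \<in> {1..r} \<Longrightarrow> 0 \<le> \<alpha> i \<and> v \<in> eigencone (A i) (\<alpha> i)"
  shows "max_matrix_monomial r m A \<otimes>\<^sub>v v = (\<Prod>i = 1..r. \<alpha> i ^ Poly_Mapping.lookup m i) *\<^sub>R v"
proof -
  have "set [1..<Suc r] = {1..r}" by auto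
  then have "prod_list (map (\<lambda>i. \<alpha> i ^ Poly_Mapping.lookup m i) [1..<Suc r])
      = (\<Prod>i = 1..r. \<alpha> i ^ Poly_Mapping.lookup m i)"
    by (metis distinct_upt prod.distinct_set_conv_list)
  moreover have "max_matrix_monomial r m A \<otimes>\<^sub>v v
      = prod_list (map (\<lambda>i. \<alpha> i ^ Poly_Mapping.lookup m i) [1..<Suc r]) *\<^sub>R v"
    unfolding max_matrix_monomial_def
    using assms by (intro max_power_product_vector_eigen) auto
  ultimately show ?thesis by simp
qed

lemma nonneg_max_poly_matrix_eval: "nonneg_matrix (max_poly_matrix_eval r p A)"
  by (simp add: nonneg_matrix_def max_poly_matrix_eval_def max_sum_nonneg)

text \<open>
  On both sides the maximum over the monomials can be pulled outside, leaving a comparison of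
  monomials, which commute with \<^term>\<open>B\<close>.
\<close>

lemma commute_max_poly_matrix_eval:
  assumes B: "nonneg_matrix B"
    and A: "\<And>i. i \<in> {1..r} \<Longrightarrow> nonneg_matrix (A i)"
    and comm: "\<And>i. i \<in> {1..r} \<Longrightarrow> B \<otimes>\<^sub>m A i = A i \<otimes>\<^sub>m B"
    and p: "max_polynomial r p"
  shows "B \<otimes>\<^sub>m max_poly_matrix_eval r p A = max_poly_matrix_eval r p A \<otimes>\<^sub>m B"
proof -
  let ?M = "\<lambda>m. max_matrix_monomial r m A"
  let ?c = "Poly_Mapping.lookup p"
  have B0: "0 \<le> B $ i $ j" for i j using B by (simp add: nonneg_matrix_def)
  have c0: "0 \<le> ?c m" for m using p by (simp add: max_polynomial_def)
  have "B \<otimes>\<^sub>m ?M m = ?M m \<otimes>\<^sub>m B" for m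
    unfolding max_matrix_monomial_def
    using assms by (intro commute_max_power_product) auto
  then have M: "(MAX k. B $ i $ k * ?M m $ k $ j) = (MAX k. ?M m $ i $ k * B $ k $ j)" for m i j
    by (simp add: max_matrix_mult_def vec_eq_iff)
  have "(B \<otimes>\<^sub>m max_poly_matrix_eval r p A) $ i $ j \<le> c \<longleftrightarrow>
        (max_poly_matrix_eval r p A \<otimes>\<^sub>m B) $ i $ j \<le> c" for i j c
  proof -
    have "(B \<otimes>\<^sub>m max_poly_matrix_eval r p A) $ i $ j \<le> c \<longleftrightarrow>
        0 \<le> c \<and> (\<forall>m \<in> Poly_Mapping.keys p. ?c m * (MAX k. B $ i $ k * ?M m $ k $ j) \<le> c)"
      using B0 c0
      by (auto simp: max_matrix_mult_def max_poly_matrix_eval_def MAX_le_iff mult_max_sum_le_iff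
          mult_MAX_le_iff mult.left_commute)
    also have "\<dots> \<longleftrightarrow> (max_poly_matrix_eval r p A \<otimes>\<^sub>m B) $ i $ j \<le> c"
      unfolding M using B0 c0
      by (auto simp: max_matrix_mult_def max_poly_matrix_eval_def MAX_le_iff max_sum_mult_le_iff
          mult_MAX_le_iff mult.assoc)
    finally show ?thesis .
  qed
  then have "(B \<otimes>\<^sub>m max_poly_matrix_eval r p A) $ i $ j = (max_poly_matrix_eval r p A \<otimes>\<^sub>m B) $ i $ j"
    for i j by (intro eq_by_upper_bounds)
  then show ?thesis by (simp add: vec_eq_iff)
qed

lemma max_poly_vector_eigen:
  assumes A: "\<And>i. i \<in> {1..r} \<Longrightarrow> nonneg_matrix (A i)"
    and p: "max_polynomial r p" and v: "0 \<le> v"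
    and eig: "\<And>i. i \<in> {1..r} \<Longrightarrow> 0 \<le> \<alpha> i \<and> v \<in> eigencone (A i) (\<alpha> i)"
  shows "max_poly_matrix_eval r p A \<otimes>\<^sub>v v = max_poly_eval r p \<alpha> *\<^sub>R v"
proof -
  let ?M = "\<lambda>m. max_matrix_monomial r m A"
  let ?c = "Poly_Mapping.lookup p"
  let ?a = "\<lambda>m. \<Prod>i = 1..r. \<alpha> i ^ Poly_Mapping.lookup m i"
  have c0: "0 \<le> ?c m" for m using p by (simp add: max_polynomial_def)
  have v0: "0 \<le> v $ i" for i using v by (simp add: less_eq_vec_def)
  have "?M m \<otimes>\<^sub>v v = ?a m *\<^sub>R v" for m
    using A v eig by (intro max_matrix_monomial_vector_eigen) auto
  then have M: "(MAX k. ?M m $ i $ k * v $ k) = ?a m * v $ i" for m i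
    by (simp add: max_matrix_vector_mult_def vec_eq_iff)
  have "(max_poly_matrix_eval r p A \<otimes>\<^sub>v v) $ i \<le> c \<longleftrightarrow> (max_poly_eval r p \<alpha> *\<^sub>R v) $ i \<le> c" for i c
  proof -
    have "(max_poly_matrix_eval r p A \<otimes>\<^sub>v v) $ i \<le> c \<longleftrightarrow>
        0 \<le> c \<and> (\<forall>m \<in> Poly_Mapping.keys p. ?c m * (MAX k. ?M m $ i $ k * v $ k) \<le> c)"
      using v0 c0
      by (auto simp: max_matrix_vector_mult_def max_poly_matrix_eval_def MAX_le_iff
          max_sum_mult_le_iff mult_MAX_le_iff mult.assoc)
    also have "\<dots> \<longleftrightarrow> (max_poly_eval r p \<alpha> *\<^sub>R v) $ i \<le> c"
      unfolding M using v0 c0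
      by (simp add: max_poly_eval_def max_sum_mult_le_iff mult.assoc)
    finally show ?thesis .
  qed
  then have "(max_poly_matrix_eval r p A \<otimes>\<^sub>v v) $ i = (max_poly_eval r p \<alpha> *\<^sub>R v) $ i" for i
    by (intro eq_by_upper_bounds)
  then show ?thesis by (simp add: vec_eq_iff)
qed

section \<open>Eigenvalues of max polynomials of commuting matrices\<close>

lemma eigencone_eigenvalue_unique:
  assumes "v \<in> eigencone A \<alpha>" "v \<in> eigencone A \<beta>" "v \<noteq> 0"
  shows "\<alpha> = \<beta>"
  using assms by (auto simp: eigencone_def)

theorem theorem3p6:
  fixes r :: nat
    and A :: "nat \<Rightarrow> real^'n^'n"
    and p :: real_mpoly
  assumes "r \<ge> 1"
    and "\<And>i. i \<in> {1..r} \<Longrightarrow> nonneg_matrix (A i)"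
    and "\<And>i j. i \<in> {1..r} \<Longrightarrow> j \<in> {1..r} \<Longrightarrow> A i \<otimes>\<^sub>m A j = A j \<otimes>\<^sub>m A i"
    and "max_polynomial r p"
  shows "(\<forall>i \<in> {1..r}. \<forall>\<alpha>\<^sub>i \<in> \<Lambda> (A i).
            \<exists>\<alpha> :: nat \<Rightarrow> real. \<alpha> i = \<alpha>\<^sub>i \<and> (\<forall>j \<in> {1..r} - {i}. \<alpha> j \<in> \<Lambda> (A j)) \<and>
              max_poly_eval r p \<alpha> \<in> \<Lambda> (max_poly_matrix_eval r p A)) \<and>
         (\<forall>\<mu> \<in> \<Lambda> (max_poly_matrix_eval r p A).
            \<exists>\<alpha> :: nat \<Rightarrow> real. (\<forall>i \<in> {1..r}. \<alpha> i \<in> \<Lambda> (A i)) \<and>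
              \<mu> = max_poly_eval r p \<alpha>)"
proof -
  let ?P = "max_poly_matrix_eval r p A"
  \<comment> \<open>Both parts are instances for a matrix commuting with all \<open>A\<^sub>j\<close>: \<open>M = A\<^sub>i\<close> and \<open>M = p(A)\<close>.\<close>
  have common: "\<exists>v \<alpha>. v \<in> eigencone M \<mu> \<and> v \<in> eigencone ?P (max_poly_eval r p \<alpha>) \<and> v \<noteq> 0 \<and>
      (\<forall>j\<in>{1..r}. \<alpha> j \<in> \<Lambda> (A j) \<and> v \<in> eigencone (A j) (\<alpha> j))"
    if M: "nonneg_matrix M" "\<mu> \<in> \<Lambda> M"
      and comm: "\<And>j. j \<in> {1..r} \<Longrightarrow> M \<otimes>\<^sub>m A j = A j \<otimes>\<^sub>m M" for M \<mu>
  proof -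
    obtain x where x: "0 \<le> \<mu>" "x \<in> eigencone M \<mu>" "x \<noteq> 0"
      using M(2) by (auto simp: max_eigenvalues_iff)
    have "\<exists>v \<alpha>. v \<in> eigencone M \<mu> \<and> v \<noteq> 0 \<and> (\<forall>j\<in>{1..r}. 0 \<le> \<alpha> j \<and> v \<in> eigencone (A j) (\<alpha> j))"
    proof (rule ex_common_eigenvector)
      show "closed_max_cone (eigencone M \<mu>)" using M x by (intro closed_max_cone_eigencone)
      show "x \<in> eigencone M \<mu>" "x \<noteq> 0" using x by auto
      show "A j \<otimes>\<^sub>v v \<in> eigencone M \<mu>" if "j \<in> {1..r}" "v \<in> eigencone M \<mu>" for j v
        using that M x comm assms(2) by (intro eigencone_invariant) auto
    qed (use assms in auto)
    then obtain v \<alpha> where v: "v \<in> eigencone M \<mu>" "v \<noteq> 0"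
        and \<alpha>: "\<And>j. j \<in> {1..r} \<Longrightarrow> 0 \<le> \<alpha> j \<and> v \<in> eigencone (A j) (\<alpha> j)"
      by blast
    have "0 \<le> v" using v by (simp add: eigencone_def)
    then have "v \<in> eigencone ?P (max_poly_eval r p \<alpha>)"
      using max_poly_vector_eigen[OF assms(2,4) _ \<alpha>] by (simp add: eigencone_def)
    moreover have "\<forall>j\<in>{1..r}. \<alpha> j \<in> \<Lambda> (A j) \<and> v \<in> eigencone (A j) (\<alpha> j)"
      using v \<alpha> by (auto simp: max_eigenvalues_iff)
    ultimately show ?thesis using v by blast
  qed
  show ?thesis
  proof (intro conjI ballI)
    fix i \<alpha>\<^sub>i assume i: "i \<in> {1..r}" "\<alpha>\<^sub>i \<in> \<Lambda> (A i)"
    then obtain v \<alpha> where v: "v \<in> eigencone (A i) \<alpha>\<^sub>i" "v \<in> eigencone ?P (max_poly_eval r p \<alpha>)" "v \<noteq> 0"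
      and \<alpha>: "\<forall>j\<in>{1..r}. \<alpha> j \<in> \<Lambda> (A j) \<and> v \<in> eigencone (A j) (\<alpha> j)"
      using common[of "A i" \<alpha>\<^sub>i] assms by blast
    have "\<alpha> i = \<alpha>\<^sub>i" using eigencone_eigenvalue_unique v \<alpha> i by blast
    moreover have "max_poly_eval r p \<alpha> \<in> \<Lambda> ?P"
      using v by (auto simp: max_eigenvalues_iff max_poly_eval_def max_sum_nonneg)
    ultimately show "\<exists>\<alpha>. \<alpha> i = \<alpha>\<^sub>i \<and> (\<forall>j \<in> {1..r} - {i}. \<alpha> j \<in> \<Lambda> (A j)) \<and>
              max_poly_eval r p \<alpha> \<in> \<Lambda> ?P"
      using \<alpha> by blast
  next
    fix \<mu> assume \<mu>: "\<mu> \<in> \<Lambda> ?P"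
    have "?P \<otimes>\<^sub>m A j = A j \<otimes>\<^sub>m ?P" if "j \<in> {1..r}" for j
      using that assms by (intro commute_max_poly_matrix_eval[symmetric]) auto
    then obtain v \<alpha> where "v \<in> eigencone ?P \<mu>" "v \<in> eigencone ?P (max_poly_eval r p \<alpha>)" "v \<noteq> 0"
      "\<forall>j\<in>{1..r}. \<alpha> j \<in> \<Lambda> (A j)"
      using common[OF nonneg_max_poly_matrix_eval \<mu>] by blast
    then show "\<exists>\<alpha>. (\<forall>i \<in> {1..r}. \<alpha> i \<in> \<Lambda> (A i)) \<and> \<mu> = max_poly_eval r p \<alpha>"
      using eigencone_eigenvalue_unique by blast
  qed
qed

end
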